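(* Let $\mathbb{C}_1,\dots,\mathbb{C}_n$ and $\mathbb{D}$ be comonads on categories $\mathcal{C}_1,\dots,\mathcal{C}_n$ and $\mathcal{D}$ respectively, and let $H\colon \mathcal{C}_1\times\dots\times\mathcal{C}_n \to \mathcal{D}$ be a functor. Suppose that for all objects $A_1\in\mathcal{C}_1,\dots,A_n\in\mathcal{C}_n$ there exists a morphism $$\kappa_{A_1,\dots,A_n}\colon \mathbb{D}(H(A_1,\dots,A_n)) \to H(\mathbb{C}_1(A_1),\dots,\mathbb{C}_n(A_n))$$ in $\mathcal{D}$ (no naturality or other condition is required). Then for all objects $A_i,B_i\in\mathcal{C}_i$ ($i=1,\dots,n$), $$A_1 \Rrightarrow_{\mathbb{C}_1} B_1,\ \dots,\ A_n \Rrightarrow_{\mathbb{C}_n} B_n \quad\text{implies}\quad H(A_1,\dots,A_n) \Rrightarrow_{\mathbb{D}} H(B_1,\dots,B_n).$$ The same holds with every $\Rrightarrow$ replaced by $\equiv^{+}$ (i.e. $A_i \equiv^+_{\mathbb{C}_i} B_i$ for all $i$ implies $H(A_1,\dots,A_n)\equiv^+_{\mathbb{D}} H(B_1,\dots,B_n)$).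
   Context: A comonad on a category $\mathcal{C}$ is a triple $(\mathbb{C},\varepsilon,\delta)$ where $\mathbb{C}\colon\mathcal{C}\to\mathcal{C}$ is a functor and $\varepsilon\colon\mathbb{C}\Rightarrow\mathrm{Id}$, $\delta\colon\mathbb{C}\Rightarrow\mathbb{C}^2$ are natural transformations with $\varepsilon_{\mathbb{C}A}\circ\delta_A=\mathrm{id}=\mathbb{C}(\varepsilon_A)\circ\delta_A$ and $\delta_{\mathbb{C}A}\circ\delta_A=\mathbb{C}(\delta_A)\circ\delta_A$. For a comonad $\mathbb{C}$ on $\mathcal{C}$ and objects $A,B$, write $A \Rrightarrow_{\mathbb{C}} B$ if there exists a morphism $\mathbb{C}(A)\to B$ in $\mathcal{C}$, and $A\equiv^{+}_{\mathbb{C}} B$ if both $A \Rrightarrow_{\mathbb{C}} B$ and $B \Rrightarrow_{\mathbb{C}} A$. *)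

theory Defs
  imports Main "HOL-Library.FuncSet"
begin

record ('o, 'm) cat =
  Obj :: "'o set"
  Arr :: "'m set"
  Dom :: "'m \<Rightarrow> 'o"
  Cod :: "'m \<Rightarrow> 'o"
  Id :: "'o \<Rightarrow> 'm"
  Comp :: "'m \<Rightarrow> 'm \<Rightarrow> 'm" (infixl "\<cdot>\<index>" 70)

text \<open>\<open>g \<cdot>\<^bsub>C\<^esub> f\<close> is \<open>g\<close> after \<open>f\<close>; it is constrained only when \<open>Cod C f = Dom C g\<close>.\<close>

definition hom :: "('o, 'm, 'x) cat_scheme \<Rightarrow> 'o \<Rightarrow> 'o \<Rightarrow> 'm set" where
  "hom C A B = {f \<in> Arr C. Dom C f = A \<and> Cod C f = B}"

locale category =
  fixes C :: "('o, 'm) cat" (structure)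
  assumes Dom_closed: "f \<in> Arr C \<Longrightarrow> Dom C f \<in> Obj C"
    and Cod_closed: "f \<in> Arr C \<Longrightarrow> Cod C f \<in> Obj C"
    and Id_hom: "A \<in> Obj C \<Longrightarrow> Id C A \<in> hom C A A"
    and Comp_hom: "\<lbrakk>f \<in> hom C X Y; g \<in> hom C Y Z\<rbrakk> \<Longrightarrow> g \<cdot> f \<in> hom C X Z"
    and Id_left: "f \<in> hom C X Y \<Longrightarrow> Id C Y \<cdot> f = f"
    and Id_right: "f \<in> hom C X Y \<Longrightarrow> f \<cdot> Id C X = f"
    and Comp_assoc: "\<lbrakk>f \<in> hom C W X; g \<in> hom C X Y; h \<in> hom C Y Z\<rbrakk>
      \<Longrightarrow> h \<cdot> (g \<cdot> f) = (h \<cdot> g) \<cdot> f"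

text \<open>Objects and arrows of the product are extensional \<open>I\<close>-indexed tuples.\<close>

definition prod_cat :: "'i set \<Rightarrow> ('i \<Rightarrow> ('o, 'm) cat) \<Rightarrow> ('i \<Rightarrow> 'o, 'i \<Rightarrow> 'm) cat" where
  "prod_cat I C =
    \<lparr>Obj = (\<Pi>\<^sub>E i\<in>I. Obj (C i)),
     Arr = (\<Pi>\<^sub>E i\<in>I. Arr (C i)),
     Dom = (\<lambda>f. \<lambda>i\<in>I. Dom (C i) (f i)),
     Cod = (\<lambda>f. \<lambda>i\<in>I. Cod (C i) (f i)),
     Id = (\<lambda>A. \<lambda>i\<in>I. Id (C i) (A i)),
     Comp = (\<lambda>g f. \<lambda>i\<in>I. Comp (C i) (g i) (f i))\<rparr>"

lemma hom_prod_cat_iff: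
  assumes "X \<in> Obj (prod_cat I C)" "Y \<in> Obj (prod_cat I C)"
  shows "f \<in> hom (prod_cat I C) X Y \<longleftrightarrow> f \<in> (\<Pi>\<^sub>E i\<in>I. hom (C i) (X i) (Y i))"
  using assms
  by (auto simp: hom_def prod_cat_def PiE_iff fun_eq_iff extensional_def restrict_def)

lemma category_prod_cat:
  assumes "\<And>i. i \<in> I \<Longrightarrow> category (C i)"
  shows "category (prod_cat I C)"
proof -
  note ax = category.Dom_closed category.Cod_closed category.Id_hom category.Comp_hom
    category.Id_left category.Id_right category.Comp_assoc
  let ?P = "prod_cat I C"
  have cl: "Dom ?P f \<in> Obj ?P" "Cod ?P f \<in> Obj ?P" if "f \<in> Arr ?P" for f
    using that ax(1,2)[OF assms] by (auto simp: prod_cat_def PiE_iff)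
  have ob: "X \<in> Obj ?P" "Y \<in> Obj ?P" if "f \<in> hom ?P X Y" for f X Y
    using that cl unfolding hom_def by auto
  have homD: "f \<in> (\<Pi>\<^sub>E i\<in>I. hom (C i) (X i) (Y i))" if "f \<in> hom ?P X Y" for f X Y
    using that ob[OF that] by (simp add: hom_prod_cat_iff)
  show ?thesis
  proof
    fix A assume A: "A \<in> Obj ?P"
    then show "Id ?P A \<in> hom ?P A A"
      using ax(3)[OF assms] by (auto simp: hom_prod_cat_iff) (auto simp: prod_cat_def PiE_iff)
  next
    fix f g X Y Z assume f: "f \<in> hom ?P X Y" and g: "g \<in> hom ?P Y Z"
    have "Comp ?P g f \<in> (\<Pi>\<^sub>E i\<in>I. hom (C i) (X i) (Z i))"
      using homD[OF f] homD[OF g] ax(4)[OF assms] by (auto simp: prod_cat_def PiE_iff)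
    then show "Comp ?P g f \<in> hom ?P X Z"
      using ob[OF f] ob[OF g] by (simp add: hom_prod_cat_iff)
  next
    fix f X Y assume f: "f \<in> hom ?P X Y"
    show "Comp ?P (Id ?P Y) f = f" "Comp ?P f (Id ?P X) = f"
      using homD[OF f] ax(5,6)[OF assms]
      by (auto simp: prod_cat_def PiE_iff fun_eq_iff extensional_def restrict_def)
  next
    fix f g h W X Y Z
    assume "f \<in> hom ?P W X" "g \<in> hom ?P X Y" "h \<in> hom ?P Y Z"
    from this[THEN homD] show "Comp ?P h (Comp ?P g f) = Comp ?P (Comp ?P h g) f"
      by (auto simp: prod_cat_def PiE_iff fun_eq_iff restrict_def intro!: ax(7)[OF assms])
  qed (use cl in auto)
qed

record ('o, 'm, 'p, 'q) functor_map =
  on_obj :: "'o \<Rightarrow> 'p"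
  on_arr :: "'m \<Rightarrow> 'q"

locale cat_functor = source: category C + target: category D
  for C :: "('o, 'm) cat" and D :: "('p, 'q) cat" +
  fixes F :: "('o, 'm, 'p, 'q) functor_map"
  assumes on_obj_closed: "A \<in> Obj C \<Longrightarrow> on_obj F A \<in> Obj D"
    and on_arr_hom: "f \<in> hom C X Y \<Longrightarrow> on_arr F f \<in> hom D (on_obj F X) (on_obj F Y)"
    and on_arr_Id: "A \<in> Obj C \<Longrightarrow> on_arr F (Id C A) = Id D (on_obj F A)"
    and on_arr_Comp: "\<lbrakk>f \<in> hom C X Y; g \<in> hom C Y Z\<rbrakk>
      \<Longrightarrow> on_arr F (g \<cdot>\<^bsub>C\<^esub> f) = on_arr F g \<cdot>\<^bsub>D\<^esub> on_arr F f"

definition id_functor :: "('o, 'm, 'o, 'm) functor_map" where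
  "id_functor = \<lparr>on_obj = (\<lambda>A. A), on_arr = (\<lambda>f. f)\<rparr>"

definition comp_functor ::
    "('p, 'q, 'r, 's) functor_map \<Rightarrow> ('o, 'm, 'p, 'q) functor_map \<Rightarrow> ('o, 'm, 'r, 's) functor_map" where
  "comp_functor G F = \<lparr>on_obj = on_obj G \<circ> on_obj F, on_arr = on_arr G \<circ> on_arr F\<rparr>"

lemma cat_functor_id:
  assumes "category C"
  shows "cat_functor C C id_functor"
  using assms by (simp add: cat_functor_def cat_functor_axioms_def id_functor_def)

lemma cat_functor_comp:
  assumes "cat_functor C D F" "cat_functor D E G"
  shows "cat_functor C E (comp_functor G F)"
proof -
  interpret F: cat_functor C D F by fact
  interpret G: cat_functor D E G by fact
  show ?thesis
    by unfold_locales
      (auto simp: comp_functor_def F.on_obj_closed G.on_obj_closed F.on_arr_Id G.on_arr_Id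
        F.on_arr_Comp G.on_arr_Comp[OF F.on_arr_hom F.on_arr_hom]
        intro: F.on_arr_hom G.on_arr_hom)
qed

locale nat_transformation = source: cat_functor C D F + target: cat_functor C D G
  for C :: "('o, 'm) cat" and D :: "('p, 'q) cat" and F G :: "('o, 'm, 'p, 'q) functor_map" +
  fixes t :: "'o \<Rightarrow> 'q"
  assumes component_hom: "A \<in> Obj C \<Longrightarrow> t A \<in> hom D (on_obj F A) (on_obj G A)"
    and naturality: "f \<in> hom C X Y \<Longrightarrow> t Y \<cdot>\<^bsub>D\<^esub> on_arr F f = on_arr G f \<cdot>\<^bsub>D\<^esub> t X"

record ('o, 'm) comonad_data =
  functor_of :: "('o, 'm, 'o, 'm) functor_map"
  counit :: "'o \<Rightarrow> 'm"
  comult :: "'o \<Rightarrow> 'm"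

locale comonad =
  category C +
  endo: cat_functor C C "functor_of T" +
  counit: nat_transformation C C "functor_of T" id_functor "counit T" +
  comult: nat_transformation C C "functor_of T" "comp_functor (functor_of T) (functor_of T)" "comult T"
  for C :: "('o, 'm) cat" (structure) and T :: "('o, 'm) comonad_data" +
  assumes counit_left: "A \<in> Obj C \<Longrightarrow>
      counit T (on_obj (functor_of T) A) \<cdot> comult T A = Id C (on_obj (functor_of T) A)"
    and counit_right: "A \<in> Obj C \<Longrightarrow>
      on_arr (functor_of T) (counit T A) \<cdot> comult T A = Id C (on_obj (functor_of T) A)"
    and coassoc: "A \<in> Obj C \<Longrightarrow>
      comult T (on_obj (functor_of T) A) \<cdot> comult T A
        = on_arr (functor_of T) (comult T A) \<cdot> comult T A"

definition comonad_le :: "('o, 'm) cat \<Rightarrow> ('o, 'm) comonad_data \<Rightarrow> 'o \<Rightarrow> 'o \<Rightarrow> bool" where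
  "comonad_le C T A B \<longleftrightarrow> (\<exists>f. f \<in> hom C (on_obj (functor_of T) A) B)"

definition comonad_equiv_pos :: "('o, 'm) cat \<Rightarrow> ('o, 'm) comonad_data \<Rightarrow> 'o \<Rightarrow> 'o \<Rightarrow> bool" where
  "comonad_equiv_pos C T A B \<longleftrightarrow> comonad_le C T A B \<and> comonad_le C T B A"

end

theory Submission
  imports Defs
begin

text \<open>Morphisms \<open>f i\<close> from \<open>T i\<close> applied to \<open>A i\<close> into
  \<open>B i\<close> assemble into a single arrow of the product category. The functor
  \<open>H\<close> carries it to an arrow into \<open>on_obj H B\<close> whose domain is exactly the
  codomain of \<kappa> at \<open>A\<close>, so composing it after \<kappa> gives the required
  morphism. The equivalence is this argument run in both directions.\<close>

theorem theorem3p2: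
  fixes n :: nat
    and C :: "nat \<Rightarrow> ('o, 'm) cat" and T :: "nat \<Rightarrow> ('o, 'm) comonad_data"
    and D :: "('p, 'q) cat" and S :: "('p, 'q) comonad_data"
    and H :: "(nat \<Rightarrow> 'o, nat \<Rightarrow> 'm, 'p, 'q) functor_map"
  assumes "\<And>i. i \<in> {1..n} \<Longrightarrow> comonad (C i) (T i)"
    and "comonad D S"
    and "cat_functor (prod_cat {1..n} C) D H"
    and "\<And>A. A \<in> Obj (prod_cat {1..n} C) \<Longrightarrow>
      \<exists>\<kappa>. \<kappa> \<in> hom D (on_obj (functor_of S) (on_obj H A))
                  (on_obj H (\<lambda>i\<in>{1..n}. on_obj (functor_of (T i)) (A i)))"
  shows "(\<forall>A \<in> Obj (prod_cat {1..n} C). \<forall>B \<in> Obj (prod_cat {1..n} C).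
            (\<forall>i\<in>{1..n}. comonad_le (C i) (T i) (A i) (B i)) \<longrightarrow>
            comonad_le D S (on_obj H A) (on_obj H B)) \<and>
         (\<forall>A \<in> Obj (prod_cat {1..n} C). \<forall>B \<in> Obj (prod_cat {1..n} C).
            (\<forall>i\<in>{1..n}. comonad_equiv_pos (C i) (T i) (A i) (B i)) \<longrightarrow>
            comonad_equiv_pos D S (on_obj H A) (on_obj H B))"
proof -
  let ?I = "{1..n}"
  let ?P = "prod_cat ?I C"
  interpret D: comonad D S by fact
  interpret H: cat_functor ?P D H by fact
  have le: "comonad_le D S (on_obj H A) (on_obj H B)"
    if A: "A \<in> Obj ?P" and B: "B \<in> Obj ?P"
      and AB: "\<forall>i\<in>?I. comonad_le (C i) (T i) (A i) (B i)" for A B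
  proof -
    let ?TA = "\<lambda>i\<in>?I. on_obj (functor_of (T i)) (A i)"
    from AB obtain f where f: "\<And>i. i \<in> ?I \<Longrightarrow> f i \<in> hom (C i) (on_obj (functor_of (T i)) (A i)) (B i)"
      unfolding comonad_le_def by metis
    \<comment> \<open>Needed for the componentwise description of homs in
      \<open>hom_prod_cat_iff\<close>; it holds because each \<open>functor_of (T i)\<close> is an
      endofunctor.\<close>
    have TA: "?TA \<in> Obj ?P"
      using A cat_functor.on_obj_closed[OF comonad.axioms(2)[OF assms(1)]]
      by (auto simp: prod_cat_def PiE_iff)
    \<comment> \<open>The chosen \<open>f\<close> is arbitrary outside \<open>?I\<close>, whereas
      arrows of the product are extensional; hence \<open>restrict\<close>.\<close>
    have "restrict f ?I \<in> hom ?P ?TA B"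
      unfolding hom_prod_cat_iff[OF TA B] using f by (simp add: PiE_iff)
    then have "on_arr H (restrict f ?I) \<in> hom D (on_obj H ?TA) (on_obj H B)"
      by (rule H.on_arr_hom)
    \<comment> \<open>The witness is the image of the tuple under \<open>H\<close> after
      \<kappa>.\<close>
    with assms(4)[OF A] show ?thesis
      unfolding comonad_le_def by (blast intro: D.Comp_hom)
  qed
  \<comment> \<open>For the equivalence, \<open>le\<close> is applied to \<open>A\<close>,
    \<open>B\<close> and to \<open>B\<close>, \<open>A\<close>.\<close>
  then show ?thesis
    by (simp add: comonad_equiv_pos_def)
qed

end
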